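(* Let $p\ge1$ and $n\ge2p$ be integers. For all $U\in\mathrm{St}(n,p)$ and all $k\in\{1,\dots,p\}$, $$d_{\mathrm E}(U,h_k(U))=\frac{\pi}{2}\|h_k(U)-U\|_{\mathrm F}=\pi\sqrt k,$$ and $\widehat M_{\mathrm E}(\delta)=M_{\mathrm E}(\delta)$ at $\delta=2\sqrt k$.
   Context: The Stiefel manifold is $\mathrm{St}(n,p)=\{U\in\mathbb{R}^{n\times p} : U^TU=I_p\}$, and $\|\cdot\|_{\mathrm F}$ is the Frobenius norm. The Euclidean geodesic distance on $\mathrm{St}(n,p)$ (induced by the metric inherited from $\mathbb{R}^{n\times p}$ with the Frobenius inner product) is $d_{\mathrm E}(U,\widetilde U)=\inf_\gamma\int_0^1\|\dot\gamma(t)\|_{\mathrm F}\,dt$, the infimum being over continuously differentiable curves $\gamma:[0,1]\to\mathrm{St}(n,p)$ with $\gamma(0)=U$, $\gamma(1)=\widetilde U$. For $k\in\{1,\dots,p\}$, $h_k(U):=U\begin{bmatrix}-I_k&0\\0&I_{p-k}\end{bmatrix}$, i.e. the first $k$ columns of $U$ change sign. For $\delta\in[0,2\sqrt p]$, $M_{\mathrm E}(\delta):=\max\{d_{\mathrm E}(U,\widetilde U) : U,\widetilde U\in\mathrm{St}(n,p),\ \|\widetilde U-U\|_{\mathrm F}=\delta\}$, and $\widehat M_{\mathrm E}(\delta):=2\arcsin(\delta/2)$ if $\delta\le2$, $\widehat M_{\mathrm E}(\delta):=\frac{\pi}{2}\delta$ otherwise. *)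

theory Defs
  imports "HOL-Analysis.Analysis"
begin

text \<open>An \<open>n \<times> p\<close> matrix is an element of \<^typ>\<open>real ^ 'p ^ 'n\<close> with \<open>n = CARD('n)\<close> and
  \<open>p = CARD('p)\<close>; the library norm of this type is the Frobenius norm:\<close>

lemma norm_eq_frobenius:
  fixes A :: "real ^ 'p ^ 'n"
  shows "norm A = sqrt (\<Sum>i\<in>UNIV. \<Sum>j\<in>UNIV. (A $ i $ j)\<^sup>2)"
  by (simp add: norm_vec_def L2_set_def sum_nonneg)

definition stiefel :: "(real ^ 'p ^ 'n) set" where
  "stiefel = {U. transpose U ** U = mat 1}"

text \<open>Derivatives are taken within \<open>[0,1]\<close>, hence one-sided at the end points.  The library's
  \<^const>\<open>C1_differentiable_on\<close> uses two-sided derivatives instead, which would depend on the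
  values of the curve outside \<open>[0,1]\<close>.\<close>

definition C1_curve_in :: "'a::real_normed_vector set \<Rightarrow> (real \<Rightarrow> 'a) \<Rightarrow> bool" where
  "C1_curve_in S \<gamma> \<longleftrightarrow> \<gamma> ` {0..1} \<subseteq> S \<and>
     (\<exists>\<gamma>'. continuous_on {0..1} \<gamma>' \<and>
        (\<forall>t\<in>{0..1}. (\<gamma> has_vector_derivative \<gamma>' t) (at t within {0..1})))"

definition curve_length :: "(real \<Rightarrow> 'a::real_normed_vector) \<Rightarrow> real" where
  "curve_length \<gamma> = integral {0..1} (\<lambda>t. norm (vector_derivative \<gamma> (at t within {0..1})))"

text \<open>If no admissible curve joins the two points, the infimum below is \<^term>\<open>Inf {} :: real\<close>
  rather than infinity.  For \<open>p < n\<close> the Stiefel manifold is connected and this does not occur.\<close>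

definition d_E :: "real ^ 'p ^ 'n \<Rightarrow> real ^ 'p ^ 'n \<Rightarrow> real" where
  "d_E U V = Inf {curve_length \<gamma> | \<gamma>. C1_curve_in stiefel \<gamma> \<and> \<gamma> 0 = U \<and> \<gamma> 1 = V}"

text \<open>The columns are ordered by the linear order of the index type: \<open>j\<close> is among the first
  \<open>k\<close> indices iff fewer than \<open>k\<close> indices lie strictly below it.\<close>

definition sign_matrix :: "nat \<Rightarrow> real ^ ('p::{finite,linorder}) ^ ('p::{finite,linorder})" where
  "sign_matrix k =
     (\<chi> i j. if i = j then (if card {l. l < j} < k then - 1 else 1) else 0)"

definition h :: "nat \<Rightarrow> real ^ ('p::{finite,linorder}) ^ 'n \<Rightarrow> real ^ ('p::{finite,linorder}) ^ 'n" where
  "h k U = U ** sign_matrix k"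

text \<open>The type argument records the format \<open>n \<times> p\<close>.  \<^const>\<open>Greatest\<close> denotes the maximum of
  the set, whereas \<^const>\<open>Max\<close> is only meaningful for finite sets.\<close>

definition M_E :: "(real ^ 'p ^ 'n) itself \<Rightarrow> real \<Rightarrow> real" where
  "M_E (_ :: (real ^ 'p ^ 'n) itself) \<delta> =
     (GREATEST d. d \<in> {d_E U V | U V :: real ^ 'p ^ 'n.
        U \<in> stiefel \<and> V \<in> stiefel \<and> norm (V - U) = \<delta>})"

definition M_E_hat :: "real \<Rightarrow> real" where
  "M_E_hat \<delta> = (if \<delta> \<le> 2 then 2 * arcsin (\<delta> / 2) else pi / 2 * \<delta>)"

end

theory Submission
  imports Defs
begin

text \<open>
  Upper bound: if \<open>p < n\<close>, some \<open>f \<in> SO(n)\<close> maps the columns of \<open>U\<close> to those of \<open>V\<close>: a product of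
  Householder reflections does so, and a reflection in a vector orthogonal to the columns of \<open>U\<close>
  corrects the determinant.  Splitting \<open>f\<close> into rotations of mutually orthogonal planes by angles
  in \<open>[0, pi]\<close> and running all of these simultaneously at constant speed joins the identity to \<open>f\<close>,
  and moves every vector \<open>x\<close> with speed at most \<open>pi / 2 * norm (f x - x)\<close>.  Applied to the columns
  this gives \<open>d_E U V \<le> pi / 2 * norm (V - U)\<close>.

  Lower bound: each of the first \<open>k\<close> columns travels between antipodal points of the unit sphere,
  and the lengths \<open>\<ge> pi\<close> of these \<open>k\<close> curves combine by Cauchy--Schwarz to \<open>pi * sqrt k\<close>.
\<close>

section \<open>Reflections and plane rotations\<close>

text \<open>A minimiser of \<open>x \<bullet> f x\<close> on the unit sphere orthogonal to
  \<open>B\<close> is critical, hence an eigenvector of \<open>f + f\<^sup>T\<close> modulo the span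
  of \<open>B\<close>. As \<open>f\<close> acts by signs on \<open>B\<close>, it preserves the
  complement and the equation holds exactly. Applying \<open>f\<close> to it removes the
  adjoint.\<close>

lemma rayleigh_critical_point:
  fixes f :: "'a::euclidean_space \<Rightarrow> 'a"
  assumes f: "orthogonal_transformation f"
    and B: "\<And>y. y \<in> B \<Longrightarrow> f y = y \<or> f y = - y"
    and "x0 \<noteq> 0" "\<And>y. y \<in> B \<Longrightarrow> x0 \<bullet> y = 0"
  obtains v where "norm v = 1" "\<And>y. y \<in> B \<Longrightarrow> v \<bullet> y = 0"
    "f (f v) = (2 * (v \<bullet> f v)) *\<^sub>R f v - v"
proof -
  have lin: "linear f" using f by (simp add: orthogonal_transformation_def)
  have inner_f: "f x \<bullet> f y = x \<bullet> y" for x y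
    using f by (simp add: orthogonal_transformation_def)
  define T where "T = {x. \<forall>y\<in>B. x \<bullet> y = 0}"
  have T: "subspace T"
    by (auto simp: T_def subspace_def inner_left_distrib)
  have "closed T" using T by (rule closed_subspace)
  then have comp: "compact (sphere 0 1 \<inter> T)" by (simp add: compact_Int_closed)
  have "x0 /\<^sub>R norm x0 \<in> sphere 0 1 \<inter> T"
    using assms(3,4) by (simp add: T_def)
  then have ne: "sphere 0 1 \<inter> T \<noteq> {}" by blast
  have cont: "continuous_on (sphere 0 1 \<inter> T) (\<lambda>x. x \<bullet> f x)"
    using lin by (intro continuous_intros linear_continuous_on) (simp add: linear_conv_bounded_linear)
  obtain v where v: "v \<in> sphere 0 1 \<inter> T"
    and vmin: "\<And>x. x \<in> sphere 0 1 \<inter> T \<Longrightarrow> v \<bullet> f v \<le> x \<bullet> f x"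
    using continuous_attains_inf[OF comp ne cont] by blast
  define c where "c = v \<bullet> f v"
  \<comment> \<open>Homogeneity of degree two carries the minimum from the sphere to the whole
    subspace \<open>T\<close>.\<close>
  have q: "c * (x \<bullet> x) \<le> x \<bullet> f x" if "x \<in> T" for x
  proof (cases "x = 0")
    case False
    have "x /\<^sub>R norm x \<in> sphere 0 1 \<inter> T"
      using that False T by (simp add: subspace_scale)
    from vmin[OF this] have "c \<le> (x \<bullet> f x) / (norm x)\<^sup>2"
      by (simp add: c_def linear_scale[OF lin] power2_eq_square field_simps)
    then show ?thesis using False
      by (simp add: power2_norm_eq_inner[symmetric] pos_le_divide_eq)
  qed (simp add: linear_0[OF lin])
  have vT: "v \<in> T" and nv: "v \<bullet> v = 1"
    using v by (auto simp: norm_eq_1)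
  have crit: "v \<bullet> f y + y \<bullet> f v = 2 * c * (v \<bullet> y)" if y: "y \<in> T" for y
  proof -
    \<comment> \<open>Testing \<open>q\<close> at \<open>v + t *\<^sub>R y\<close> gives
      \<open>t * l + t\<^sup>2 * m \<ge> 0\<close> for every \<open>t\<close>, which forces the
      first variation \<open>l\<close> to vanish.\<close>
    define l where "l = v \<bullet> f y + y \<bullet> f v - 2 * c * (v \<bullet> y)"
    define m where "m = y \<bullet> f y - c * (y \<bullet> y)"
    have "0 \<le> t * l + t\<^sup>2 * m" for t
    proof -
      have "v + t *\<^sub>R y \<in> T" using vT y T by (simp add: subspace_add subspace_scale)
      from q[OF this] show ?thesis
        by (simp add: l_def m_def linear_add[OF lin] linear_scale[OF lin] inner_add_left
            inner_add_right nv c_def[symmetric] inner_commute[of y v] power2_eq_square algebra_simps)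
    qed
    note pos = this
    have "l = 0"
    proof (rule ccontr)
      assume l: "l \<noteq> 0"
      \<comment> \<open>The denominator is positive and exceeds \<open>m\<close>, so the negative
        linear term outweighs the quadratic one.\<close>
      define t where "t = - l / (1 + \<bar>m\<bar>)"
      have "t * l + t\<^sup>2 * m = (l\<^sup>2 / (1 + \<bar>m\<bar>)) * (m / (1 + \<bar>m\<bar>) - 1)"
        unfolding t_def by (simp only: power2_eq_square right_diff_distrib times_divide_times_eq) simp
      also have "\<dots> < 0"
        using l by (intro mult_pos_neg) (auto simp: field_simps)
      finally show False using pos[of t] by simp
    qed
    then show ?thesis by (simp add: l_def)
  qed
  \<comment> \<open>\<open>z\<close> is \<open>f\<close> applied to the gradient
    \<open>f v + f\<^sup>T v - 2 * c * v\<close> of the Lagrangian. Its preimage \<open>y\<close>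
    lies in \<open>T\<close>, and criticality in the direction \<open>y\<close> says
    \<open>z \<bullet> z = 0\<close>.\<close>
  define z where "z = f (f v) - (2 * c) *\<^sub>R f v + v"
  obtain y where zy: "z = f y"
    using orthogonal_transformation_surj[OF f] by (metis surj_def)
  have "f v \<bullet> b = 0 \<and> f (f v) \<bullet> b = 0 \<and> v \<bullet> b = 0" if "b \<in> B" for b
  proof -
    have *: "f x \<bullet> b = 0" if "x \<bullet> b = 0" for x
      using B[OF \<open>b \<in> B\<close>] inner_f[of x b] that by auto
    have "v \<bullet> b = 0" using vT \<open>b \<in> B\<close> by (simp add: T_def)
    then show ?thesis using * by blast
  qed
  then have zb: "z \<bullet> b = 0" if "b \<in> B" for b
    using that by (simp add: z_def inner_add_left inner_diff_left)
  have "y \<bullet> b = 0" if "b \<in> B" for b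
    using inner_f[of y b] B[OF that] zb[OF that] zy by auto
  then have "y \<in> T" by (simp add: T_def)
  from crit[OF this] have "z \<bullet> f y = 0"
    by (simp add: z_def inner_add_left inner_diff_left inner_f inner_commute algebra_simps)
  then have "z = 0" using zy by simp
  then show thesis
    using that[of v] nv vT by (simp add: z_def c_def norm_eq_1 T_def algebra_simps)
qed

section \<open>Reflections\<close>

text \<open>Division by zero makes \<open>reflect 0\<close> the identity.\<close>

definition reflect :: "'a::real_inner \<Rightarrow> 'a \<Rightarrow> 'a" where
  "reflect w x = x - (2 * (x \<bullet> w) / (w \<bullet> w)) *\<^sub>R w"

lemma orthogonal_transformation_reflect: "orthogonal_transformation (reflect w)"
proof (cases "w = 0")
  case False
  have "linear (reflect w)"
    by (rule linearI) (auto simp: reflect_def algebra_simps inner_add_left add_divide_distrib)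
  moreover have "reflect w x \<bullet> reflect w y = x \<bullet> y" for x y
    using False by (simp add: reflect_def inner_diff_left inner_diff_right inner_commute field_simps)
  ultimately show ?thesis by (simp add: orthogonal_transformation_def)
qed (simp add: reflect_def[abs_def])

lemma reflect_fixes: "x \<bullet> w = 0 \<Longrightarrow> reflect w x = x"
  by (simp add: reflect_def)

lemma reflect_swaps:
  assumes "norm a = norm b"
  shows "reflect (a - b) a = b"
proof (cases "a = b")
  case False
  have eq: "a \<bullet> a = b \<bullet> b" using assms by (simp add: norm_eq)
  have "(a - b) \<bullet> (a - b) = 2 * (a \<bullet> (a - b))"
    using eq by (simp add: inner_diff_left inner_diff_right inner_commute)
  moreover have "(a - b) \<bullet> (a - b) \<noteq> 0" using False by simp
  ultimately show ?thesis by (simp add: reflect_def)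
qed (simp add: reflect_def)

lemma det_matrix_compose:
  fixes f g :: "real ^ 'n \<Rightarrow> real ^ 'n"
  assumes "linear f" "linear g"
  shows "det (matrix (f \<circ> g)) = det (matrix f) * det (matrix g)"
  using assms by (simp add: matrix_compose det_mul)

text \<open>An orthogonal map taking a coordinate vector to \<open>e\<close> conjugates the
  reflection in \<open>e\<close> to a diagonal one with a single entry \<open>- 1\<close>, and the
  determinant is invariant under conjugation.\<close>

lemma det_reflect:
  fixes e :: "real ^ 'n"
  assumes "norm e = 1"
  shows "det (matrix (reflect e)) = - 1"
proof -
  obtain k :: 'n where True by simp
  let ?a = "axis k 1 :: real ^ 'n"
  have "norm ?a = 1" by simp
  then obtain f where f: "orthogonal_transformation f" and fa: "f ?a = e"
    using orthogonal_transformation_exists_1 assms by metis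
  note lins = orthogonal_transformation_linear[OF f]
    orthogonal_transformation_linear[OF orthogonal_transformation_reflect]
  have "reflect e (f x) = f (reflect ?a x)" for x
    using f by (simp add: reflect_def fa[symmetric] linear_diff[OF lins(1)] linear_scale[OF lins(1)]
        orthogonal_transformation_def)
  then have "reflect e \<circ> f = f \<circ> reflect ?a" by auto
  then have "det (matrix (reflect e)) * det (matrix f) = det (matrix f) * det (matrix (reflect ?a))"
    using det_matrix_compose lins by metis
  moreover have "det (matrix f) \<noteq> 0"
    using orthogonal_transformation_det[OF f] by auto
  moreover have "det (matrix (reflect ?a)) = - 1"
  proof -
    have nth: "matrix (reflect ?a) $ i $ j = (if i = j then (if i = k then - 1 else 1) else 0)" for i j
      by (auto simp: matrix_def reflect_def inner_axis_axis) (auto simp: axis_def)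
    have "det (matrix (reflect ?a)) = (\<Prod>i\<in>UNIV. if i = k then - 1 else 1)"
      by (subst det_diagonal) (auto simp: nth)
    then show ?thesis by (simp add: prod.If_cases)
  qed
  ultimately have "(det (matrix (reflect e)) + 1) * det (matrix f) = 0" "det (matrix f) \<noteq> 0"
    by (simp_all add: algebra_simps)
  then show ?thesis by simp
qed

section \<open>Rotations of a plane\<close>

text \<open>The formula is the identity plus a correction along \<open>v\<close> and
  \<open>w\<close>: for orthonormal \<open>v\<close>, \<open>w\<close> it turns their plane by
  \<open>\<theta>\<close> and fixes the orthogonal complement, without splitting \<open>x\<close>
  explicitly.\<close>

definition plane_rotation :: "'a::real_inner \<Rightarrow> 'a \<Rightarrow> real \<Rightarrow> 'a \<Rightarrow> 'a" where
  "plane_rotation v w \<theta> x = x + ((cos \<theta> - 1) * (x \<bullet> v) - sin \<theta> * (x \<bullet> w)) *\<^sub>R v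
     + (sin \<theta> * (x \<bullet> v) + (cos \<theta> - 1) * (x \<bullet> w)) *\<^sub>R w"

lemma linear_plane_rotation: "linear (plane_rotation v w \<theta>)"
  by (rule linearI) (auto simp: plane_rotation_def algebra_simps inner_add_left)

context
  fixes v w :: "'a::real_inner"
  assumes vw: "norm v = 1" "norm w = 1" "v \<bullet> w = 0"
begin

private lemma vw': "v \<bullet> v = 1" "w \<bullet> w = 1" "w \<bullet> v = 0"
  using vw by (auto simp: norm_eq_1 inner_commute)

lemma norm_plane_decomposition:
  assumes "z \<bullet> v = 0" "z \<bullet> w = 0"
  shows "(norm (a *\<^sub>R v + b *\<^sub>R w + z))\<^sup>2 = a\<^sup>2 + b\<^sup>2 + (norm z)\<^sup>2"
proof -
  have "v \<bullet> z = 0" "w \<bullet> z = 0" using assms by (simp_all add: inner_commute)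
  then show ?thesis
    unfolding power2_norm_eq_inner
    by (simp add: inner_add_left inner_add_right assms vw vw' power2_eq_square)
qed

lemma plane_rotation_compose:
  "plane_rotation v w \<alpha> (plane_rotation v w \<beta> x) = plane_rotation v w (\<alpha> + \<beta>) x"
proof -
  have 1: "plane_rotation v w \<beta> x \<bullet> v = cos \<beta> * (x \<bullet> v) - sin \<beta> * (x \<bullet> w)"
    and 2: "plane_rotation v w \<beta> x \<bullet> w = sin \<beta> * (x \<bullet> v) + cos \<beta> * (x \<bullet> w)"
    using vw vw' by (simp_all add: plane_rotation_def inner_add_left algebra_simps)
  have collect: "x + a *\<^sub>R v + b *\<^sub>R w + a' *\<^sub>R v + b' *\<^sub>R w = x + (a + a') *\<^sub>R v + (b + b') *\<^sub>R w"
    for a a' b b' :: real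
    by (simp add: scaleR_add_left)
  have v_coeff: "(cos \<beta> - 1) * p - sin \<beta> * q
        + ((cos \<alpha> - 1) * (cos \<beta> * p - sin \<beta> * q) - sin \<alpha> * (sin \<beta> * p + cos \<beta> * q))
      = (cos (\<alpha> + \<beta>) - 1) * p - sin (\<alpha> + \<beta>) * q"
    and w_coeff: "sin \<beta> * p + (cos \<beta> - 1) * q
        + (sin \<alpha> * (cos \<beta> * p - sin \<beta> * q) + (cos \<alpha> - 1) * (sin \<beta> * p + cos \<beta> * q))
      = sin (\<alpha> + \<beta>) * p + (cos (\<alpha> + \<beta>) - 1) * q" for p q
    unfolding cos_add sin_add by algebra+
  show ?thesis
    unfolding plane_rotation_def[of v w \<alpha>] 1 2
    unfolding plane_rotation_def collect v_coeff w_coeff ..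
qed

lemma orthogonal_transformation_plane_rotation:
  "orthogonal_transformation (plane_rotation v w \<theta>)"
  unfolding orthogonal_transformation
proof (intro conjI allI linear_plane_rotation)
  fix x
  let ?a = "x \<bullet> v" and ?b = "x \<bullet> w"
  let ?z = "x - ?a *\<^sub>R v - ?b *\<^sub>R w"
  have z: "?z \<bullet> v = 0" "?z \<bullet> w = 0"
    using vw vw' by (simp_all add: inner_diff_left)
  have "plane_rotation v w \<theta> x
      = (cos \<theta> * ?a - sin \<theta> * ?b) *\<^sub>R v + (sin \<theta> * ?a + cos \<theta> * ?b) *\<^sub>R w + ?z"
    by (simp add: plane_rotation_def algebra_simps)
  then have "(norm (plane_rotation v w \<theta> x))\<^sup>2
      = (cos \<theta> * ?a - sin \<theta> * ?b)\<^sup>2 + (sin \<theta> * ?a + cos \<theta> * ?b)\<^sup>2 + (norm ?z)\<^sup>2"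
    by (simp only: norm_plane_decomposition[OF z])
  also have "(cos \<theta> * ?a - sin \<theta> * ?b)\<^sup>2 + (sin \<theta> * ?a + cos \<theta> * ?b)\<^sup>2
      = (?a\<^sup>2 + ?b\<^sup>2) * ((cos \<theta>)\<^sup>2 + (sin \<theta>)\<^sup>2)"
    by (simp only: power2_eq_square) (simp only: algebra_simps)
  also have "\<dots> + (norm ?z)\<^sup>2 = (norm (?a *\<^sub>R v + ?b *\<^sub>R w + ?z))\<^sup>2"
    by (simp only: norm_plane_decomposition[OF z] sin_cos_squared_add2 mult_1_right)
  finally show "norm (plane_rotation v w \<theta> x) = norm x" by simp
qed

end

text \<open>A rotation is the square of the rotation by half the angle, and the determinant 1 or - 1
  of an orthogonal map squares to 1.\<close>

lemma det_plane_rotation: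
  fixes v w :: "real ^ 'n"
  assumes "norm v = 1" "norm w = 1" "v \<bullet> w = 0"
  shows "det (matrix (plane_rotation v w \<theta>)) = 1"
proof -
  have "plane_rotation v w \<theta> = plane_rotation v w (\<theta> / 2) \<circ> plane_rotation v w (\<theta> / 2)"
    by (simp add: fun_eq_iff plane_rotation_compose[OF assms])
  then have "det (matrix (plane_rotation v w \<theta>)) = (det (matrix (plane_rotation v w (\<theta> / 2))))\<^sup>2"
    using det_matrix_compose[OF linear_plane_rotation linear_plane_rotation]
    by (metis power2_eq_square)
  also have "\<dots> = 1"
    using orthogonal_transformation_det[OF orthogonal_transformation_plane_rotation[OF assms], of "\<theta>/2"]
    by (metis power2_abs power_one)
  finally show ?thesis .
qed

section \<open>Arcs, chords and rotation planes\<close>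

lemma sin_ge_chord:
  assumes "0 \<le> x" "x \<le> pi / 2"
  shows "2 / pi * x \<le> sin x"
proof -
  have "concave_on {0..pi/2} sin"
    by (rule f''_le0_imp_concave[where f' = cos and f'' = "\<lambda>x. - sin x"])
      (auto intro!: derivative_eq_intros sin_ge_zero)
  from concave_onD[OF this, of "2 / pi * x" 0 "pi / 2"] show ?thesis
    using assms by (simp add: field_simps)
qed

text \<open>By the half-angle formula \<open>2 - 2 * cos \<theta>\<close> is the squared chord of an
  arc \<open>\<theta>\<close> on the unit circle, and Jordan's inequality compares the two. The
  factor \<open>pi / 2\<close> of the upper bound originates here.\<close>

lemma angle_le_chord:
  assumes "0 \<le> \<theta>" "\<theta> \<le> pi"
  shows "\<theta>\<^sup>2 \<le> (pi / 2)\<^sup>2 * (2 - 2 * cos \<theta>)"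
proof -
  have "\<theta> / pi \<le> sin (\<theta> / 2)"
    using sin_ge_chord[of "\<theta> / 2"] assms by simp
  then have "(\<theta> / pi)\<^sup>2 \<le> (sin (\<theta> / 2))\<^sup>2"
    using assms by (intro power_mono) auto
  moreover have "cos \<theta> = 1 - 2 * (sin (\<theta> / 2))\<^sup>2"
    using cos_double_sin[of "\<theta> / 2"] by simp
  then have "(pi / 2)\<^sup>2 * (2 - 2 * cos \<theta>) = pi\<^sup>2 * (sin (\<theta> / 2))\<^sup>2"
    by (simp add: power_divide)
  ultimately show ?thesis
    by (simp add: power_divide pos_divide_le_eq mult.commute)
qed

text \<open>Unless \<open>f\<close> is the identity or a reflection, minimising \<open>x \<bullet> f x\<close> over unit vectors orthogonal to
  the fixed space yields an eigenvector \<open>v\<close> of \<open>f + f\<^sup>T\<close>; the span of \<open>v\<close> and \<open>f v\<close> is the plane,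
  except that eigenvectors for \<open>- 1\<close> have to be paired with each other.\<close>

lemma rotation_plane_exists:
  fixes f :: "real ^ 'n \<Rightarrow> real ^ 'n"
  assumes f: "orthogonal_transformation f" and det: "det (matrix f) = 1"
    and "f x1 \<noteq> x1"
  obtains v w \<theta> where "norm v = 1" "norm w = 1" "v \<bullet> w = 0" "0 < \<theta>" "\<theta> \<le> pi"
    "f v = cos \<theta> *\<^sub>R v + sin \<theta> *\<^sub>R w" "f w = cos \<theta> *\<^sub>R w - sin \<theta> *\<^sub>R v"
proof -
  note plane = that
  have lin: "linear f" using f by (simp add: orthogonal_transformation_def)
  have inner_f: "f x \<bullet> f y = x \<bullet> y" for x y
    using f by (simp add: orthogonal_transformation_def)
  define F where "F = {x. f x = x}"
  have F: "subspace F"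
    by (auto simp: F_def subspace_def linear_0[OF lin] linear_add[OF lin] linear_scale[OF lin])
  \<comment> \<open>With \<open>c = cos \<theta>\<close>, \<open>w\<close> is the normalised part of
    \<open>f v\<close> orthogonal to \<open>v\<close>; the equation for \<open>f (f v)\<close> keeps
    \<open>f w\<close> in the plane. For \<open>c = 1\<close> or \<open>c = - 1\<close>,
    \<open>f v\<close> would be parallel to \<open>v\<close>.\<close>
  have generic: thesis if v: "norm v = 1" and ffv: "f (f v) = (2 * (v \<bullet> f v)) *\<^sub>R f v - v"
    and c: "- 1 < v \<bullet> f v" and "f v \<noteq> v" for v
  proof -
    define c where "c = v \<bullet> f v"
    define s where "s = sqrt (1 - c\<^sup>2)"
    have vv: "v \<bullet> v = 1" "f v \<bullet> f v = 1" using v inner_f by (auto simp: norm_eq_1)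
    have "(norm (f v - v))\<^sup>2 = 2 - 2 * c"
      by (simp add: power2_norm_eq_inner inner_diff_left inner_diff_right vv c_def inner_commute)
    moreover have "0 < (norm (f v - v))\<^sup>2" using \<open>f v \<noteq> v\<close> by simp
    ultimately have "c < 1" by linarith
    have c1: "- 1 < c" using c by (simp add: c_def)
    have "0 < 1 - c\<^sup>2" using \<open>c < 1\<close> c1 by (simp add: abs_square_less_1)
    then have s: "0 < s" "s\<^sup>2 = 1 - c\<^sup>2" by (simp_all add: s_def)
    define w where "w = (f v - c *\<^sub>R v) /\<^sub>R s"
    define \<theta> where "\<theta> = arccos c"
    have cs: "cos \<theta> = c" "sin \<theta> = s"
      using c1 \<open>c < 1\<close> by (simp_all add: \<theta>_def s_def sin_arccos)
    have sw: "s *\<^sub>R w = f v - c *\<^sub>R v" using s by (simp add: w_def)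
    have "s\<^sup>2 * (w \<bullet> w) = (s *\<^sub>R w) \<bullet> (s *\<^sub>R w)" by (simp add: power2_eq_square)
    also have "\<dots> = s\<^sup>2"
      unfolding sw s(2)
      by (simp add: inner_diff_left inner_diff_right vv c_def inner_commute power2_eq_square)
    finally have "norm w = 1" using s(1) by (simp add: norm_eq_1)
    moreover have "v \<bullet> w = 0"
      by (simp add: w_def inner_diff_right vv c_def)
    moreover have "0 < \<theta>" "\<theta> \<le> pi"
      using c1 \<open>c < 1\<close> arccos_lt_bounded[of c] by (auto simp: \<theta>_def)
    moreover have "f v = cos \<theta> *\<^sub>R v + sin \<theta> *\<^sub>R w" by (simp add: cs sw)
    moreover have "f w = cos \<theta> *\<^sub>R w - sin \<theta> *\<^sub>R v"
    proof -
      have "s *\<^sub>R f w = f (f v) - c *\<^sub>R f v"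
        by (simp add: linear_scale[OF lin, symmetric] sw linear_diff[OF lin])
      also have "\<dots> = c *\<^sub>R f v - v"
        by (simp add: ffv c_def[symmetric] algebra_simps flip: scaleR_add_left)
      also have "\<dots> = c *\<^sub>R (f v - c *\<^sub>R v) - s\<^sup>2 *\<^sub>R v"
        unfolding s(2) by (simp add: algebra_simps power2_eq_square)
      also have "\<dots> = s *\<^sub>R (c *\<^sub>R w - s *\<^sub>R v)"
        by (simp add: sw[symmetric] algebra_simps power2_eq_square)
      finally show ?thesis using s(1) by (simp add: cs)
    qed
    ultimately show thesis using plane[of v w \<theta>] v by blast
  qed
  have perp: "\<exists>x0. x0 \<noteq> 0 \<and> (\<forall>y\<in>S. x0 \<bullet> y = 0)" if "x \<notin> S" "subspace S" for S and x :: "real ^ 'n"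
  proof -
    have "span S \<subset> UNIV" using that by (metis UNIV_I psubsetI span_eq_iff top_greatest)
    then obtain x0 where "x0 \<noteq> 0" "\<And>y. y \<in> span S \<Longrightarrow> orthogonal x0 y"
      using orthogonal_to_subspace_exists_gen[of S UNIV] by (metis span_UNIV)
    then show ?thesis by (meson orthogonal_def span_base)
  qed
  have minus: "f v = - v" if "norm v = 1" "v \<bullet> f v = - 1" for v
  proof -
    have "v \<bullet> v = 1" "f v \<bullet> f v = 1" using that inner_f by (auto simp: norm_eq_1)
    then have "(f v + v) \<bullet> (f v + v) = 0"
      using that by (simp add: inner_add_left inner_add_right inner_commute)
    then show ?thesis by (simp add: add_eq_0_iff2)
  qed
  have bound: "- 1 \<le> v \<bullet> f v" if "norm v = 1" for v
    using Cauchy_Schwarz_ineq2[of v "f v"] that orthogonal_transformation_norm[OF f, of v] by simp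
  have moved: "f v \<noteq> v" if "norm v = 1" "\<And>y. y \<in> F \<Longrightarrow> v \<bullet> y = 0" for v
    using that by (auto simp: F_def norm_eq_1)
  have "x1 \<notin> F" using assms by (simp add: F_def)
  then obtain x0 where x0: "x0 \<noteq> 0" "\<forall>y\<in>F. x0 \<bullet> y = 0" using perp F by blast
  obtain v where v: "norm v = 1" "\<And>y. y \<in> F \<Longrightarrow> v \<bullet> y = 0"
    "f (f v) = (2 * (v \<bullet> f v)) *\<^sub>R f v - v"
  proof (rule rayleigh_critical_point[OF f, of F x0])
    show "f y = y \<or> f y = - y" if "y \<in> F" for y using that by (simp add: F_def)
  qed (use x0 in auto)
  show thesis
  proof (cases "v \<bullet> f v = - 1")
    case False
    then have "- 1 < v \<bullet> f v" using bound[OF v(1)] by simp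
    then show ?thesis using generic[OF v(1,3)] moved[OF v(1,2)] by simp
  next
    case True
    then have fv: "f v = - v" using minus v by blast
    show ?thesis
    proof (cases "span (insert v F) = UNIV")
      \<comment> \<open>Here \<open>f\<close> is the identity on the hyperplane \<open>F\<close> and
        negates its normal \<open>v\<close>, so it is a reflection, against determinant 1.\<close>
      case True
      have "f x = reflect v x" for x
      proof -
        obtain k where k: "x - k *\<^sub>R v \<in> F"
          using True span_breakdown_eq[of x v F] F by (metis UNIV_I span_eq_iff)
        then have "f (x - k *\<^sub>R v) = x - k *\<^sub>R v" by (simp add: F_def)
        then have "f x = x - (2 * k) *\<^sub>R v"
          by (simp add: linear_diff[OF lin] linear_scale[OF lin] fv algebra_simps
              flip: scaleR_add_left)
        moreover have "x \<bullet> v = k"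
          using v(2)[OF k] v(1) by (simp add: inner_diff_right norm_eq_1 inner_commute)
        ultimately show ?thesis using v(1) by (simp add: reflect_def norm_eq_1)
      qed
      then have "f = reflect v" by auto
      then show ?thesis using det det_reflect[OF v(1)] by simp
    next
      case False
      then obtain x where "x \<notin> span (insert v F)" by blast
      then obtain x2 where x2: "x2 \<noteq> 0" "\<forall>y\<in>span (insert v F). x2 \<bullet> y = 0"
        using perp[of x "span (insert v F)"] by auto
      \<comment> \<open>A second critical point is sought orthogonal to \<open>v\<close> as well,
        which is possible because \<open>f\<close> acts on \<open>insert v F\<close> by
        signs.\<close>
      obtain w where w: "norm w = 1" "\<And>y. y \<in> insert v F \<Longrightarrow> w \<bullet> y = 0"
        "f (f w) = (2 * (w \<bullet> f w)) *\<^sub>R f w - w"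
      proof (rule rayleigh_critical_point[OF f, of "insert v F" x2])
        show "f y = y \<or> f y = - y" if "y \<in> insert v F" for y
          using that fv by (auto simp: F_def)
      qed (use x2 in \<open>auto simp: span_base\<close>)
      show ?thesis
      proof (cases "w \<bullet> f w = - 1")
        case False
        then have "- 1 < w \<bullet> f w" using bound[OF w(1)] by simp
        moreover have "f w \<noteq> w" using moved[OF w(1)] w(2) by simp
        ultimately show ?thesis using generic[OF w(1,3)] by simp
      next
        case True
        then have "f w = - w" using minus w by blast
        then show ?thesis using plane[of v w pi] v w fv by (simp add: inner_commute)
      qed
    qed
  qed
qed

section \<open>Paths of rotations\<close>

text \<open>The angles of the rotation planes lie in \<open>{0..pi}\<close>, so each chord \<open>f x - x\<close> is at least
  \<open>2 / pi\<close> times as long as the arc from \<open>x\<close> to \<open>f x\<close>.\<close>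

lemma rotation_path_exists:
  fixes f :: "real ^ 'n \<Rightarrow> real ^ 'n"
  assumes "orthogonal_transformation f" "det (matrix f) = 1"
  obtains E E' :: "real \<Rightarrow> real ^ 'n \<Rightarrow> real ^ 'n"
  where "\<And>t. orthogonal_transformation (E t)" "\<And>x. E 0 x = x" "\<And>x. E 1 x = f x"
    "\<And>x t. ((\<lambda>s. E s x) has_vector_derivative E' t x) (at t)"
    "\<And>x. continuous_on UNIV (\<lambda>t. E' t x)"
    "\<And>x t. norm (E' t x) \<le> pi / 2 * norm (f x - x)"
proof -
  have "\<exists>E E'. (\<forall>t. orthogonal_transformation (E t)) \<and> (\<forall>x. E 0 x = x) \<and> (\<forall>x. E 1 x = f x) \<and>
    (\<forall>x t. ((\<lambda>s. E s x) has_vector_derivative E' t x) (at t)) \<and>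
    (\<forall>x. continuous_on UNIV (\<lambda>t. E' t x)) \<and>
    (\<forall>x t. norm (E' t x) \<le> pi / 2 * norm (f x - x))"
    using assms
  \<comment> \<open>The induction is on the codimension of the fixed space; every plane that is
    split off lowers it.\<close>
  proof (induction "CARD('n) - dim {x. f x = x}" arbitrary: f rule: less_induct)
    case less
    note f = less.prems(1)
    have lin: "linear f" using f by (simp add: orthogonal_transformation_def)
    have inner_f: "f x \<bullet> f y = x \<bullet> y" for x y
      using f by (simp add: orthogonal_transformation_def)
    show ?case
    proof (cases "\<forall>x. f x = x")
      case True
      then show ?thesis
        by (intro exI[of _ "\<lambda>t x. x"] exI[of _ "\<lambda>t x. 0"]) auto
    next
      case False
      then obtain v w \<theta> where vw: "norm v = 1" "norm w = 1" "v \<bullet> w = 0" and \<theta>: "0 < \<theta>" "\<theta> \<le> pi"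
        and fv: "f v = cos \<theta> *\<^sub>R v + sin \<theta> *\<^sub>R w" and fw: "f w = cos \<theta> *\<^sub>R w - sin \<theta> *\<^sub>R v"
        using rotation_plane_exists[OF less.prems] by blast
      have vw': "v \<bullet> v = 1" "w \<bullet> w = 1" "w \<bullet> v = 0"
        using vw by (auto simp: norm_eq_1 inner_commute)
      \<comment> \<open>\<open>g\<close> first undoes the turn in the plane and then applies
        \<open>f\<close>: it fixes \<open>v\<close> and \<open>w\<close>, equals \<open>f\<close> on
        their complement and still has determinant 1.\<close>
      define g where "g = f \<circ> plane_rotation v w (- \<theta>)"
      have g: "orthogonal_transformation g"
        unfolding g_def
        by (intro orthogonal_transformation_compose f orthogonal_transformation_plane_rotation vw)
      have "det (matrix g) = 1"
        unfolding g_def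
        by (simp add: det_matrix_compose lin linear_plane_rotation less.prems det_plane_rotation vw)
      have ring: "cos \<theta> * (cos \<theta> * r) + sin \<theta> * (sin \<theta> * r) = r" for r
        using sin_cos_squared_add2[of \<theta>] by (simp add: power2_eq_square algebra_simps flip: distrib_left)
      have "f (cos \<theta> *\<^sub>R v - sin \<theta> *\<^sub>R w) = v"
        using ring[of 1]
        by (simp add: linear_diff[OF lin] linear_scale[OF lin] fv fw algebra_simps flip: scaleR_add_left)
      then have gv: "g v = v"
        by (simp add: g_def plane_rotation_def vw vw' algebra_simps)
      have "f (cos \<theta> *\<^sub>R w + sin \<theta> *\<^sub>R v) = w"
        using ring[of 1]
        by (simp add: linear_add[OF lin] linear_scale[OF lin] fv fw algebra_simps flip: scaleR_add_left)
      then have gw: "g w = w"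
        by (simp add: g_def plane_rotation_def vw vw' algebra_simps)
      have g_perp: "g z = f z" if "z \<bullet> v = 0" "z \<bullet> w = 0" for z
        using that by (simp add: g_def plane_rotation_def)
      have cos: "cos \<theta> < 1" using cos_monotone_0_pi[of 0 \<theta>] \<theta> by simp
      \<comment> \<open>A vector fixed by \<open>f\<close> has no component in the plane because
        \<open>cos \<theta> < 1\<close>. So every fixed vector of \<open>f\<close> is fixed by
        \<open>g\<close>, which in addition fixes \<open>v\<close>.\<close>
      have fixed_perp: "x \<bullet> v = 0 \<and> x \<bullet> w = 0" if "f x = x" for x
      proof -
        have "x \<bullet> v = cos \<theta> * (x \<bullet> v) + sin \<theta> * (x \<bullet> w)"
          using inner_f[of x v] by (simp add: that fv inner_add_right)
        then have 1: "(1 - cos \<theta>) * (x \<bullet> v) = sin \<theta> * (x \<bullet> w)" by (simp add: algebra_simps)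
        have "x \<bullet> w = cos \<theta> * (x \<bullet> w) - sin \<theta> * (x \<bullet> v)"
          using inner_f[of x w] by (simp add: that fw inner_diff_right)
        then have 2: "(1 - cos \<theta>) * (x \<bullet> w) = - sin \<theta> * (x \<bullet> v)" by (simp add: algebra_simps)
        have "(1 - cos \<theta>) * ((x \<bullet> v)\<^sup>2 + (x \<bullet> w)\<^sup>2)
            = ((1 - cos \<theta>) * (x \<bullet> v)) * (x \<bullet> v) + ((1 - cos \<theta>) * (x \<bullet> w)) * (x \<bullet> w)"
          by (simp add: power2_eq_square algebra_simps)
        also have "\<dots> = 0" unfolding 1 2 by (simp add: algebra_simps)
        finally show ?thesis using cos by (simp add: sum_power2_eq_zero_iff)
      qed
      have "dim {x. f x = x} < dim {x. g x = x}"
      proof -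
        let ?F = "{x. f x = x}"
        have "subspace ?F"
          by (auto simp: subspace_def linear_0[OF lin] linear_add[OF lin] linear_scale[OF lin])
        then have "span ?F = ?F" by (simp only: span_eq_iff)
        moreover have "v \<notin> ?F" using fixed_perp[of v] vw' by auto
        ultimately have "dim (insert v ?F) = dim ?F + 1" unfolding dim_insert by presburger
        moreover have "dim (insert v ?F) \<le> dim {x. g x = x}"
          using gv g_perp fixed_perp by (intro dim_subset) auto
        ultimately show ?thesis by linarith
      qed
      moreover have "dim {x. g x = x} \<le> CARD('n)"
        using dim_subset_UNIV[of "{x. g x = x}"] by simp
      ultimately have "CARD('n) - dim {x. g x = x} < CARD('n) - dim {x. f x = x}" by linarith
      from less.hyps[OF this g \<open>det (matrix g) = 1\<close>] obtain E E' where
        E: "\<And>t. orthogonal_transformation (E t)" and E0: "\<And>x. E 0 x = x" and E1: "\<And>x. E 1 x = g x"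
        and E': "\<And>x t. ((\<lambda>s. E s x) has_vector_derivative E' t x) (at t)"
        and cE': "\<And>x. continuous_on UNIV (\<lambda>t. E' t x)"
        and bE': "\<And>x t. norm (E' t x) \<le> pi / 2 * norm (g x - x)"
        by blast
      have linE: "linear (E t)" and inner_E: "E t x \<bullet> E t y = x \<bullet> y" for t x y
        using E[of t] by (auto simp: orthogonal_transformation_def)
      \<comment> \<open>The speed bound also encodes stationarity: where \<open>g y = y\<close> it
        forces the derivative to vanish.\<close>
      have E_fix: "E t y = y" if "g y = y" for y t
      proof -
        have "((\<lambda>s. E s y) has_vector_derivative 0) (at s within UNIV)" for s
          using E'[of y s] bE'[of s y] that by simp
        then obtain k where "\<And>s. E s y = k"
          using has_vector_derivative_zero_constant[of UNIV "\<lambda>s. E s y"] by auto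
        then show ?thesis using E0[of y] by metis
      qed
      define z where "z x = x - (x \<bullet> v) *\<^sub>R v - (x \<bullet> w) *\<^sub>R w" for x
      have zvw: "z x \<bullet> v = 0" "z x \<bullet> w = 0" for x
        using vw vw' by (simp_all add: z_def inner_diff_left)
      have zadd: "z (x + y) = z x + z y" and zscale: "z (r *\<^sub>R x) = r *\<^sub>R z x" for x y r
        by (simp_all add: z_def inner_add_left algebra_simps)
      have dec: "x = (x \<bullet> v) *\<^sub>R v + (x \<bullet> w) *\<^sub>R w + z x" for x by (simp add: z_def)
      have Ez: "E t (z x) \<bullet> v = 0" "E t (z x) \<bullet> w = 0" for t x
        using inner_E[of t "z x" v] inner_E[of t "z x" w] E_fix gv gw zvw by auto
      define a where "a t x = cos (t * \<theta>) * (x \<bullet> v) - sin (t * \<theta>) * (x \<bullet> w)" for t x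
      define b where "b t x = sin (t * \<theta>) * (x \<bullet> v) + cos (t * \<theta>) * (x \<bullet> w)" for t x
      have ab: "(a t x)\<^sup>2 + (b t x)\<^sup>2 = (x \<bullet> v)\<^sup>2 + (x \<bullet> w)\<^sup>2" for t x
      proof -
        have "(a t x)\<^sup>2 + (b t x)\<^sup>2 = ((cos (t * \<theta>))\<^sup>2 + (sin (t * \<theta>))\<^sup>2) * ((x \<bullet> v)\<^sup>2 + (x \<bullet> w)\<^sup>2)"
          by (simp only: a_def b_def power2_eq_square) (simp only: algebra_simps)
        then show ?thesis by simp
      qed
      \<comment> \<open>The plane part turns through \<open>t * \<theta>\<close> while the
        complementary part follows \<open>E\<close>; by \<open>Ez\<close> the two stay
        orthogonal.\<close>
      define G where "G t x = a t x *\<^sub>R v + b t x *\<^sub>R w + E t (z x)" for t x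
      define G' where "G' t x = (- \<theta> * b t x) *\<^sub>R v + (\<theta> * a t x) *\<^sub>R w + E' t (z x)" for t x
      have fx: "f x = a 1 x *\<^sub>R v + b 1 x *\<^sub>R w + f (z x)" for x
      proof -
        have "f x = f ((x \<bullet> v) *\<^sub>R v + (x \<bullet> w) *\<^sub>R w + z x)" using dec[of x, symmetric] by simp
        also have "\<dots> = (x \<bullet> v) *\<^sub>R f v + (x \<bullet> w) *\<^sub>R f w + f (z x)"
          by (simp add: linear_add[OF lin] linear_scale[OF lin])
        also have "\<dots> = a 1 x *\<^sub>R v + b 1 x *\<^sub>R w + f (z x)"
          by (simp add: fv fw a_def b_def algebra_simps)
        finally show ?thesis .
      qed
      have "orthogonal_transformation (G t)" for t
        unfolding orthogonal_transformation
      proof (intro conjI allI)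
        show "linear (G t)"
          by (rule linearI)
            (simp_all add: G_def a_def b_def zadd zscale linear_add[OF linE] linear_scale[OF linE]
              inner_add_left algebra_simps)
        fix x
        have "(norm (G t x))\<^sup>2 = (a t x)\<^sup>2 + (b t x)\<^sup>2 + (norm (E t (z x)))\<^sup>2"
          unfolding G_def by (rule norm_plane_decomposition[OF vw Ez])
        also have "\<dots> = (norm ((x \<bullet> v) *\<^sub>R v + (x \<bullet> w) *\<^sub>R w + z x))\<^sup>2"
          unfolding norm_plane_decomposition[OF vw zvw] ab orthogonal_transformation_norm[OF E] ..
        finally show "norm (G t x) = norm x" using dec[of x, symmetric] by simp
      qed
      moreover have "G 0 x = x" for x
        using dec[of x, symmetric] by (simp add: G_def a_def b_def E0)
      moreover have "G 1 x = f x" for x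
        unfolding G_def E1 g_perp[OF zvw] by (rule fx[symmetric])
      moreover have "((\<lambda>s. G s x) has_vector_derivative G' t x) (at t)" for x t
        unfolding G_def G'_def a_def b_def
        by (intro has_vector_derivative_add E')
          (auto intro!: derivative_eq_intros simp: has_vector_derivative_def fun_eq_iff algebra_simps)
      moreover have "continuous_on UNIV (\<lambda>t. G' t x)" for x
        unfolding G'_def a_def b_def by (intro continuous_intros cE')
      moreover have "norm (G' t x) \<le> pi / 2 * norm (f x - x)" for x t
      proof -
        \<comment> \<open>The velocity of a curve confined to the complement of \<open>y\<close> is
          itself orthogonal to \<open>y\<close>, so the squared speed of \<open>G\<close> splits by
          Pythagoras.\<close>
        have perp: "E' t (z x) \<bullet> y = 0" if "\<And>s. E s (z x) \<bullet> y = 0" for y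
        proof -
          have "((\<lambda>s. E s (z x) \<bullet> y) has_vector_derivative E' t (z x) \<bullet> y) (at t)"
            using bounded_linear.has_vector_derivative[OF bounded_linear_inner_left E'] .
          then have "((\<lambda>s. 0) has_vector_derivative E' t (z x) \<bullet> y) (at t)" using that by simp
          then show ?thesis using has_vector_derivative_const vector_derivative_unique_at by blast
        qed
        let ?Q = "(a 1 x - x \<bullet> v)\<^sup>2 + (b 1 x - x \<bullet> w)\<^sup>2"
        have "(norm (G' t x))\<^sup>2 = (- \<theta> * b t x)\<^sup>2 + (\<theta> * a t x)\<^sup>2 + (norm (E' t (z x)))\<^sup>2"
          unfolding G'_def by (rule norm_plane_decomposition[OF vw perp perp]) (rule Ez)+
        also have "(- \<theta> * b t x)\<^sup>2 + (\<theta> * a t x)\<^sup>2 = \<theta>\<^sup>2 * ((x \<bullet> v)\<^sup>2 + (x \<bullet> w)\<^sup>2)"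
          unfolding ab[of t, symmetric] by (simp add: power_mult_distrib distrib_left)
        finally have G': "(norm (G' t x))\<^sup>2
          = \<theta>\<^sup>2 * ((x \<bullet> v)\<^sup>2 + (x \<bullet> w)\<^sup>2) + (norm (E' t (z x)))\<^sup>2" .
        have "\<theta>\<^sup>2 * ((x \<bullet> v)\<^sup>2 + (x \<bullet> w)\<^sup>2)
            \<le> (pi / 2)\<^sup>2 * (2 - 2 * cos \<theta>) * ((x \<bullet> v)\<^sup>2 + (x \<bullet> w)\<^sup>2)"
          using \<theta> by (intro mult_right_mono angle_le_chord) auto
        moreover have "(2 - 2 * cos \<theta>) * ((x \<bullet> v)\<^sup>2 + (x \<bullet> w)\<^sup>2) = ?Q"
        proof -
          have "?Q = (a 1 x)\<^sup>2 + (b 1 x)\<^sup>2 + (x \<bullet> v)\<^sup>2 + (x \<bullet> w)\<^sup>2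
              - 2 * (a 1 x * (x \<bullet> v) + b 1 x * (x \<bullet> w))"
            by (simp only: power2_eq_square) (simp only: algebra_simps mult_2)
          also have "a 1 x * (x \<bullet> v) + b 1 x * (x \<bullet> w) = cos \<theta> * ((x \<bullet> v)\<^sup>2 + (x \<bullet> w)\<^sup>2)"
            by (simp add: a_def b_def power2_eq_square algebra_simps)
          also have "(a 1 x)\<^sup>2 + (b 1 x)\<^sup>2 + (x \<bullet> v)\<^sup>2 + (x \<bullet> w)\<^sup>2 = 2 * ((x \<bullet> v)\<^sup>2 + (x \<bullet> w)\<^sup>2)"
            using ab[of 1 x] by simp
          finally show ?thesis by (simp add: algebra_simps)
        qed
        ultimately have plane: "\<theta>\<^sup>2 * ((x \<bullet> v)\<^sup>2 + (x \<bullet> w)\<^sup>2) \<le> (pi / 2)\<^sup>2 * ?Q"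
          by (metis mult.assoc)
        have rest: "(norm (E' t (z x)))\<^sup>2 \<le> (pi / 2)\<^sup>2 * (norm (f (z x) - z x))\<^sup>2"
          unfolding power_mult_distrib[symmetric]
          using bE'[of t "z x"] g_perp zvw by (intro power_mono) auto
        have "f x - x = (a 1 x *\<^sub>R v + b 1 x *\<^sub>R w + f (z x))
            - ((x \<bullet> v) *\<^sub>R v + (x \<bullet> w) *\<^sub>R w + z x)"
          by (rule arg_cong2[of _ _ _ _ "(-)"]) (rule fx, rule dec)
        also have "\<dots> = (a 1 x - x \<bullet> v) *\<^sub>R v + (b 1 x - x \<bullet> w) *\<^sub>R w + (f (z x) - z x)"
          by (simp add: algebra_simps)
        also have "(norm \<dots>)\<^sup>2 = ?Q + (norm (f (z x) - z x))\<^sup>2"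
          using Ez[of 1 x] zvw g_perp
          by (intro norm_plane_decomposition[OF vw]) (simp_all add: E1 inner_diff_left)
        finally have "(pi / 2 * norm (f x - x))\<^sup>2
            = (pi / 2)\<^sup>2 * ?Q + (pi / 2)\<^sup>2 * (norm (f (z x) - z x))\<^sup>2"
          by (simp only: power_mult_distrib distrib_left)
        with G' plane rest have "(norm (G' t x))\<^sup>2 \<le> (pi / 2 * norm (f x - x))\<^sup>2"
          by linarith
        then show ?thesis by (rule power2_le_imp_le) simp
      qed
      ultimately show ?thesis by (intro exI[of _ G] exI[of _ G']) blast
    qed
  qed
  then show thesis using that by blast
qed

section \<open>Curves in the Stiefel manifold\<close>

text \<open>Induction adds one vector at a time: reflecting in \<open>f (a k) - b k\<close> moves
  \<open>f (a k)\<close> to \<open>b k\<close>. The equal inner products make each earlier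
  \<open>b j\<close> orthogonal to \<open>f (a k) - b k\<close>, so these images stay put.\<close>

lemma orthogonal_transformation_extends:
  fixes a b :: "'i \<Rightarrow> 'a::euclidean_space"
  assumes "finite J" "\<And>i j. i \<in> J \<Longrightarrow> j \<in> J \<Longrightarrow> a i \<bullet> a j = b i \<bullet> b j"
  shows "\<exists>f. orthogonal_transformation f \<and> (\<forall>j\<in>J. f (a j) = b j)"
  using assms
proof (induction J rule: finite_induct)
  case empty
  show ?case using orthogonal_transformation_id by blast
next
  case (insert k J)
  then obtain f where f: "orthogonal_transformation f" "\<And>j. j \<in> J \<Longrightarrow> f (a j) = b j"
    by auto
  let ?r = "reflect (f (a k) - b k)"
  have "orthogonal_transformation (?r \<circ> f)"
    by (intro orthogonal_transformation_compose orthogonal_transformation_reflect f)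
  moreover have "?r (f (a j)) = b j" if "j \<in> insert k J" for j
  proof (cases "j = k")
    case True
    have "norm (a k) = norm (b k)" using insert.prems[of k k] by (simp add: norm_eq)
    then show ?thesis
      using True reflect_swaps orthogonal_transformation_norm[OF f(1)] by metis
  next
    case False
    with that have j: "j \<in> J" by simp
    have "f (a j) \<bullet> f (a k) = b j \<bullet> b k"
      using f(1) insert.prems[of j k] j by (simp add: orthogonal_transformation_def)
    then show ?thesis
      using f(2)[OF j] by (auto intro: reflect_fixes simp: inner_diff_right)
  qed
  ultimately show ?case by (intro exI[of _ "\<lambda>x. ?r (f x)"]) (simp add: comp_def)
qed

lemma rotation_extends:
  fixes a b :: "'i \<Rightarrow> real ^ 'n"
  assumes "finite J" "card J < CARD('n)"
    and "\<And>i j. i \<in> J \<Longrightarrow> j \<in> J \<Longrightarrow> a i \<bullet> a j = b i \<bullet> b j"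
  obtains f where "orthogonal_transformation f" "det (matrix f) = 1" "\<And>j. j \<in> J \<Longrightarrow> f (a j) = b j"
proof -
  obtain f where f: "orthogonal_transformation f" "\<And>j. j \<in> J \<Longrightarrow> f (a j) = b j"
    using orthogonal_transformation_extends[of J a b] assms(1,3) by blast
  show thesis
  proof (cases "det (matrix f) = 1")
    case True
    then show ?thesis using that f by blast
  next
    case False
    then have det: "det (matrix f) = - 1"
      using orthogonal_transformation_det[OF f(1)] by linarith
    have "dim (a ` J) \<le> card (a ` J)" using assms(1) by (intro dim_le_card') simp
    also have "\<dots> \<le> card J" using assms(1) by (rule card_image_le)
    finally have "dim (a ` J) < DIM(real ^ 'n)" using assms(2) by simp
    then obtain x where x: "x \<noteq> 0" "\<And>y. y \<in> span (a ` J) \<Longrightarrow> orthogonal x y"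
      using orthogonal_to_subspace_exists by blast
    define e where "e = x /\<^sub>R norm x"
    have "norm e = 1" using x by (simp add: e_def)
    let ?g = "f \<circ> reflect e"
    have "orthogonal_transformation ?g"
      by (intro orthogonal_transformation_compose orthogonal_transformation_reflect f)
    moreover have "det (matrix ?g) = 1"
      using det_matrix_compose[of f "reflect e"] f(1) det det_reflect[OF \<open>norm e = 1\<close>]
        orthogonal_transformation_linear orthogonal_transformation_reflect by fastforce
    moreover have "?g (a j) = b j" if "j \<in> J" for j
    proof -
      have "a j \<bullet> e = 0"
        using x(2)[of "a j"] that by (simp add: span_base orthogonal_def e_def inner_commute)
      then show ?thesis using f(2)[OF that] by (simp add: reflect_fixes)
    qed
    ultimately show ?thesis using that by blast
  qed
qed

section \<open>Columns and curve lengths\<close>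

lemma stiefel_iff_columns:
  "U \<in> stiefel \<longleftrightarrow> (\<forall>i j. column i U \<bullet> column j U = (if i = j then 1 else 0))"
  by (simp add: stiefel_def vec_eq_iff matrix_matrix_mult_def transpose_def mat_def
      inner_vec_def column_def)

lemma norm_eq_columns:
  fixes A :: "real ^ 'p ^ 'n"
  shows "(norm A)\<^sup>2 = (\<Sum>j\<in>UNIV. (norm (column j A))\<^sup>2)"
proof -
  have "(norm A)\<^sup>2 = (\<Sum>i\<in>UNIV. \<Sum>j\<in>UNIV. (A $ i $ j)\<^sup>2)"
    by (simp add: norm_eq_frobenius sum_nonneg)
  also have "\<dots> = (\<Sum>j\<in>UNIV. (norm (column j A))\<^sup>2)"
    unfolding power2_norm_eq_inner
    by (subst sum.swap) (simp add: inner_vec_def column_def power2_eq_square)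
  finally show ?thesis .
qed

lemma bounded_linear_column: "bounded_linear (\<lambda>A :: real ^ 'p ^ 'n. column j A)"
  by (rule linear_conv_bounded_linear[THEN iffD1], rule linearI) (simp_all add: column_def vec_eq_iff)

lemma column_diff:
  fixes A B :: "real ^ 'p ^ 'n"
  shows "column j (A - B) = column j A - column j B"
  by (simp add: column_def vec_eq_iff)

lemma has_vector_derivative_columns:
  fixes c c' :: "'p::finite \<Rightarrow> real \<Rightarrow> real ^ 'n"
  assumes "\<And>j. (c j has_vector_derivative c' j t) F"
  shows "((\<lambda>t. \<chi> i j. c j t $ i) has_vector_derivative (\<chi> i j. c' j t $ i)) F"
proof -
  let ?L = "\<lambda>j x. (\<chi> i j'. if j' = j then x $ i else 0) :: real ^ 'p ^ 'n"
  have L: "bounded_linear (?L j)" for j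
    by (rule linear_conv_bounded_linear[THEN iffD1], rule linearI) (simp_all add: vec_eq_iff)
  have sum_L: "(\<chi> i j. d j $ i) = (\<Sum>j\<in>UNIV. ?L j (d j))" for d :: "'p \<Rightarrow> real ^ 'n"
    by (simp add: vec_eq_iff sum_component)
  show ?thesis
    unfolding sum_L
    by (intro has_vector_derivative_sum bounded_linear.has_vector_derivative[OF L] assms)
qed

text \<open>Derivatives within \<open>{0..1}\<close> are unique even at the end points, so any known
  derivative computes the length.\<close>

lemma curve_length_eq:
  fixes \<gamma> :: "real \<Rightarrow> 'a::euclidean_space"
  assumes "\<And>t. t \<in> {0..1} \<Longrightarrow> (\<gamma> has_vector_derivative \<gamma>' t) (at t within {0..1})"
  shows "curve_length \<gamma> = integral {0..1} (\<lambda>t. norm (\<gamma>' t))"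
  unfolding curve_length_def
  by (intro integral_cong arg_cong[of _ _ norm]
      vector_derivative_within_closed_interval[of 0 1] assms) auto

text \<open>A speed that is not integrable has integral 0 by default, so the bound covers arbitrary
  \<open>\<gamma>\<close>.\<close>

lemma curve_length_nonneg: "0 \<le> curve_length \<gamma>"
  unfolding curve_length_def
  by (metis integral_nonneg norm_ge_zero not_integrable_integral order_refl)

section \<open>Upper bound for the distance\<close>

text \<open>Both matrices have orthonormal columns, so one rotation carries the columns of
  \<open>U\<close> to those of \<open>V\<close>. Its path moves all columns at once, which keeps
  them orthonormal, and the squared speed bounds of the columns add up to that for the Frobenius
  norm.\<close>

lemma short_curve_exists:
  fixes U V :: "real ^ 'p ^ 'n"
  assumes "CARD('p) < CARD('n)" "U \<in> stiefel" "V \<in> stiefel"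
  obtains \<gamma> where "C1_curve_in stiefel \<gamma>" "\<gamma> 0 = U" "\<gamma> 1 = V"
    "curve_length \<gamma> \<le> pi / 2 * norm (V - U)"
proof -
  obtain f where f: "orthogonal_transformation f" "det (matrix f) = 1"
    "\<And>j. f (column j U) = column j V"
    using rotation_extends[of UNIV "\<lambda>j. column j U" "\<lambda>j. column j V"] assms
    by (auto simp: stiefel_iff_columns)
  obtain E E' where E: "\<And>t. orthogonal_transformation (E t)" "\<And>x. E 0 x = x" "\<And>x. E 1 x = f x"
    and E': "\<And>x t. ((\<lambda>s. E s x) has_vector_derivative E' t x) (at t)"
    "\<And>x. continuous_on UNIV (\<lambda>t. E' t x)"
    "\<And>x t. norm (E' t x) \<le> pi / 2 * norm (f x - x)"
    using rotation_path_exists[OF f(1,2)] by blast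
  define \<gamma> where "\<gamma> t = (\<chi> i j. E t (column j U) $ i)" for t
  define \<gamma>' where "\<gamma>' t = (\<chi> i j. E' t (column j U) $ i)" for t
  have col: "column j (\<gamma> t) = E t (column j U)" "column j (\<gamma>' t) = E' t (column j U)" for j t
    by (simp_all add: \<gamma>_def \<gamma>'_def column_def vec_eq_iff)
  have st: "\<gamma> t \<in> stiefel" for t
    using assms(2) E(1)[of t]
    by (simp add: stiefel_iff_columns col orthogonal_transformation_def)
  have deriv: "(\<gamma> has_vector_derivative \<gamma>' t) (at t within {0..1})" for t
    unfolding \<gamma>_def[abs_def] \<gamma>'_def
    by (rule has_vector_derivative_columns) (rule has_vector_derivative_at_within[OF E'(1)])
  have cont: "continuous_on {0..1} \<gamma>'"
    unfolding \<gamma>'_def[abs_def]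
    by (intro continuous_on_vec_lambda continuous_on_component continuous_on_subset[OF E'(2)]) simp
  have "norm (\<gamma>' t) \<le> pi / 2 * norm (V - U)" for t
  proof -
    have "(norm (\<gamma>' t))\<^sup>2 \<le> (\<Sum>j\<in>UNIV. (pi / 2 * norm (column j V - column j U))\<^sup>2)"
      unfolding norm_eq_columns col f(3)[symmetric]
      by (intro sum_mono power_mono E'(3)) simp
    also have "\<dots> = (pi / 2 * norm (V - U))\<^sup>2"
      by (simp only: power_mult_distrib norm_eq_columns[of "V - U"] sum_distrib_left column_diff)
    finally show ?thesis by (rule power2_le_imp_le) simp
  qed
  then have "integral {0..1} (\<lambda>t. norm (\<gamma>' t)) \<le> integral {0..1} (\<lambda>t::real. pi / 2 * norm (V - U))"
    by (intro integral_le integrable_continuous_interval continuous_on_norm cont) auto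
  then have "curve_length \<gamma> \<le> pi / 2 * norm (V - U)"
    using curve_length_eq[OF deriv] by simp
  moreover have "\<gamma> 0 = U" "\<gamma> 1 = V"
    by (simp_all add: \<gamma>_def vec_eq_iff E f(3)) (simp_all add: column_def)
  moreover have "C1_curve_in stiefel \<gamma>"
    unfolding C1_curve_in_def using st deriv cont by blast
  ultimately show thesis using that by blast
qed

lemma bdd_below_curve_lengths:
  "bdd_below {curve_length \<gamma> |\<gamma>. C1_curve_in stiefel \<gamma> \<and> \<gamma> 0 = U \<and> \<gamma> 1 = V}"
  using curve_length_nonneg by (intro bdd_belowI[of _ 0]) auto

lemma d_E_le:
  fixes U V :: "real ^ 'p ^ 'n"
  assumes "CARD('p) < CARD('n)" "U \<in> stiefel" "V \<in> stiefel"
  shows "d_E U V \<le> pi / 2 * norm (V - U)"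
proof -
  obtain \<gamma> where "C1_curve_in stiefel \<gamma>" "\<gamma> 0 = U" "\<gamma> 1 = V"
    and le: "curve_length \<gamma> \<le> pi / 2 * norm (V - U)"
    using short_curve_exists assms by blast
  then have "d_E U V \<le> curve_length \<gamma>"
    unfolding d_E_def by (intro cInf_lower bdd_below_curve_lengths) auto
  with le show ?thesis by simp
qed

section \<open>Lower bound for antipodal columns\<close>

text \<open>The factor \<open>r < 1\<close> keeps \<open>arcsin\<close> away from its singularities.\<close>

lemma sphere_arcsin_derivative_bound:
  fixes c c' u :: "'a::real_inner"
  assumes "norm c = 1" "norm u = 1" "c \<bullet> c' = 0" "0 < r" "r < 1"
  shows "\<bar>r * (c' \<bullet> u) / sqrt (1 - (r * (c \<bullet> u))\<^sup>2)\<bar> \<le> norm c'" and "\<bar>r * (c \<bullet> u)\<bar> < 1"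
proof -
  define x where "x = c \<bullet> u"
  have "\<bar>x\<bar> \<le> 1" using Cauchy_Schwarz_ineq2[of c u] assms by (simp add: x_def)
  have "\<bar>r * x\<bar> \<le> r" using mult_left_mono[OF \<open>\<bar>x\<bar> \<le> 1\<close>, of r] assms(4) by (simp add: abs_mult)
  then show lt: "\<bar>r * (c \<bullet> u)\<bar> < 1" using assms(5) by (simp add: x_def)
  have uu: "u \<bullet> u = 1" "c \<bullet> c = 1" using assms by (simp_all add: norm_eq_1)
  \<comment> \<open>Since \<open>c'\<close> is tangent to the sphere, only the part of
    \<open>u\<close> orthogonal to \<open>c\<close> counts; its squared length is
    \<open>1 - x\<^sup>2\<close>.\<close>
  have "c' \<bullet> u = c' \<bullet> (u - x *\<^sub>R c)"
    using assms(3) by (simp add: inner_diff_right inner_commute)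
  then have "(c' \<bullet> u)\<^sup>2 \<le> (c' \<bullet> c') * ((u - x *\<^sub>R c) \<bullet> (u - x *\<^sub>R c))"
    using Cauchy_Schwarz_ineq by metis
  also have "(u - x *\<^sub>R c) \<bullet> (u - x *\<^sub>R c) = 1 - x\<^sup>2"
    by (simp add: inner_diff_left inner_diff_right uu x_def inner_commute[of u c] power2_eq_square)
  finally have "r\<^sup>2 * (c' \<bullet> u)\<^sup>2 \<le> r\<^sup>2 * ((c' \<bullet> c') * (1 - x\<^sup>2))"
    by (intro mult_left_mono) simp_all
  also have "\<dots> = (c' \<bullet> c') * (r\<^sup>2 - (r * x)\<^sup>2)"
    by (simp add: power_mult_distrib algebra_simps)
  \<comment> \<open>Replacing the leading \<open>r\<^sup>2\<close> by 1 matches the radicand in the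
    derivative of \<open>arcsin\<close>.\<close>
  also have "\<dots> \<le> (c' \<bullet> c') * (1 - (r * x)\<^sup>2)"
    using assms(4,5) by (intro mult_left_mono) (simp_all add: power_le_one)
  finally have "(r * (c' \<bullet> u))\<^sup>2 \<le> (norm c')\<^sup>2 * (1 - (r * x)\<^sup>2)"
    by (simp add: power_mult_distrib power2_norm_eq_inner)
  then have "sqrt ((r * (c' \<bullet> u))\<^sup>2) \<le> sqrt ((norm c')\<^sup>2 * (1 - (r * x)\<^sup>2))"
    by (rule real_sqrt_le_mono)
  then have "\<bar>r * (c' \<bullet> u)\<bar> \<le> norm c' * sqrt (1 - (r * x)\<^sup>2)"
    by (simp add: real_sqrt_mult)
  moreover have "0 < sqrt (1 - (r * x)\<^sup>2)"
    using lt by (simp add: x_def abs_square_less_1)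
  ultimately show "\<bar>r * (c' \<bullet> u) / sqrt (1 - (r * (c \<bullet> u))\<^sup>2)\<bar> \<le> norm c'"
    by (simp only: x_def abs_divide abs_of_pos pos_divide_le_eq)
qed

text \<open>For each column in \<open>K\<close>, \<open>arcsin (r * (c j t \<bullet> c j 0))\<close>
  changes no faster than the column moves, and it goes from \<open>arcsin r\<close> to
  \<open>- arcsin r\<close>. Summation over \<open>K\<close> and Cauchy--Schwarz bound the length
  below; letting \<open>r\<close> tend to 1 gives \<open>pi\<close>.\<close>

lemma curve_length_antipodal_columns:
  fixes U V :: "real ^ 'p ^ 'n"
  assumes \<gamma>: "C1_curve_in stiefel \<gamma>" "\<gamma> 0 = U" "\<gamma> 1 = V"
    and K: "\<And>j. j \<in> K \<Longrightarrow> column j V = - column j U"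
  shows "pi * sqrt (card K) \<le> curve_length \<gamma>"
proof -
  obtain \<gamma>' where cont: "continuous_on {0..1} \<gamma>'"
    and deriv: "\<And>t. t \<in> {0..1} \<Longrightarrow> (\<gamma> has_vector_derivative \<gamma>' t) (at t within {0..1})"
    and st: "\<And>t. t \<in> {0..1} \<Longrightarrow> \<gamma> t \<in> stiefel"
    using \<gamma>(1) unfolding C1_curve_in_def by blast
  define c where "c j t = column j (\<gamma> t)" for j t
  define c' where "c' j t = column j (\<gamma>' t)" for j t
  have dc: "(c j has_vector_derivative c' j t) (at t within {0..1})" if "t \<in> {0..1}" for j t
    unfolding c_def[abs_def] c'_def
    by (rule bounded_linear.has_vector_derivative[OF bounded_linear_column deriv[OF that]])
  have unit: "norm (c j t) = 1" if "t \<in> {0..1}" for j t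
    using st[OF that] by (simp add: stiefel_iff_columns c_def norm_eq_1)
  \<comment> \<open>The inner product is constantly 1 on the interval, so its product-rule
    derivative must be 0.\<close>
  have tangent: "c j t \<bullet> c' j t = 0" if t: "t \<in> {0..1}" for j t
  proof -
    have "((\<lambda>s. c j s \<bullet> c j s) has_vector_derivative (c j t \<bullet> c' j t + c' j t \<bullet> c j t)) (at t within {0..1})"
      using has_derivative_inner[OF dc[OF t, unfolded has_vector_derivative_def]
          dc[OF t, unfolded has_vector_derivative_def]]
      by (simp add: has_vector_derivative_def algebra_simps)
    from vector_derivative_within_closed_interval[OF _ t this]
    have "vector_derivative (\<lambda>s. c j s \<bullet> c j s) (at t within {0..1}) = 2 * (c j t \<bullet> c' j t)"
      by (simp add: inner_commute)
    moreover have "((\<lambda>s. c j s \<bullet> c j s) has_vector_derivative 0) (at t within {0..1})"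
      by (rule has_vector_derivative_transform[OF t _ has_vector_derivative_const[of 1]])
        (simp add: unit flip: norm_eq_1)
    note vector_derivative_within_closed_interval[OF _ t this]
    ultimately show ?thesis by simp
  qed
  \<comment> \<open>A fraction \<open>z < 1\<close> of the bound is proved first, because
    \<open>arcsin\<close> is not differentiable at 1, the value of
    \<open>c j t \<bullet> c j 0\<close> at time 0. The scaling \<open>r\<close> is chosen so that
    \<open>arcsin r = z * (pi / 2)\<close>.\<close>
  have "z * (pi * sqrt (card K)) \<le> curve_length \<gamma>" if z: "0 < z" "z < 1" for z
  proof -
    define r where "r = sin (z * (pi / 2))"
    have z2: "0 < z * (pi / 2)" "z * (pi / 2) < pi / 2" using z by simp_all
    have "0 < r" using z2 sin_gt_zero[of "z * (pi / 2)"] unfolding r_def by linarith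
    have "r < 1" using z2 sin_monotone_2pi[of "z * (pi / 2)" "pi / 2"] unfolding r_def by simp
    have arcsin_r: "arcsin r = z * (pi / 2)" unfolding r_def using z2 by (intro arcsin_sin) linarith+
    define G where "G t = (\<Sum>j\<in>K. arcsin (r * (c j t \<bullet> c j 0)))" for t
    define G' where "G' t = (\<Sum>j\<in>K. r * (c' j t \<bullet> c j 0) / sqrt (1 - (r * (c j t \<bullet> c j 0))\<^sup>2))" for t
    note bound = sphere_arcsin_derivative_bound[OF unit unit tangent \<open>0 < r\<close> \<open>r < 1\<close>]
    have dG: "(G has_vector_derivative G' t) (at t within {0..1})" if t: "t \<in> {0..1}" for t
      unfolding G_def[abs_def] G'_def
    proof (rule has_vector_derivative_sum)
      fix j
      let ?x = "r * (c j t \<bullet> c j 0)"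
      have "((\<lambda>t. c j t \<bullet> c j 0) has_real_derivative (c' j t \<bullet> c j 0)) (at t within {0..1})"
        unfolding has_real_derivative_iff_has_vector_derivative
        by (rule bounded_linear.has_vector_derivative[OF bounded_linear_inner_left dc[OF t]])
      then have "((\<lambda>t. r * (c j t \<bullet> c j 0)) has_real_derivative r * (c' j t \<bullet> c j 0)) (at t within {0..1})"
        by (rule DERIV_cmult)
      moreover have "(arcsin has_real_derivative inverse (sqrt (1 - ?x\<^sup>2))) (at ?x)"
        using bound(2)[OF t _ t, of 0 j] by (intro DERIV_arcsin) (simp_all add: abs_less_iff minus_less_iff)
      ultimately show "((\<lambda>t. arcsin (r * (c j t \<bullet> c j 0))) has_vector_derivative
          r * (c' j t \<bullet> c j 0) / sqrt (1 - ?x\<^sup>2)) (at t within {0..1})"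
        unfolding has_real_derivative_iff_has_vector_derivative[symmetric]
        using DERIV_chain2 by (fastforce simp: divide_inverse mult.commute)
    qed
    have G': "\<bar>G' t\<bar> \<le> sqrt (card K) * norm (\<gamma>' t)" if t: "t \<in> {0..1}" for t
    proof -
      have "\<bar>G' t\<bar> \<le> (\<Sum>j\<in>K. \<bar>r * (c' j t \<bullet> c j 0) / sqrt (1 - (r * (c j t \<bullet> c j 0))\<^sup>2)\<bar>)"
        unfolding G'_def by (rule sum_abs)
      also have "\<dots> \<le> (\<Sum>j\<in>K. norm (c' j t))"
        using bound(1)[OF t _ t] by (intro sum_mono) auto
      also have "\<dots> \<le> sqrt (card K) * norm (\<gamma>' t)"
      proof (rule power2_le_imp_le)
        \<comment> \<open>Cauchy--Schwarz against the constant 1 costs the factor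
          \<open>sqrt (card K)\<close>; the columns in \<open>K\<close> are only some of those in
          the Frobenius norm.\<close>
        have "(\<Sum>j\<in>K. norm (c' j t))\<^sup>2 \<le> (\<Sum>j\<in>K. (norm (c' j t))\<^sup>2) * (\<Sum>j\<in>K. 1\<^sup>2)"
          using Cauchy_Schwarz_ineq_sum[of "\<lambda>j. norm (c' j t)" "\<lambda>_. 1" K] by simp
        also have "\<dots> \<le> (norm (\<gamma>' t))\<^sup>2 * (\<Sum>j\<in>K. 1\<^sup>2)"
          unfolding norm_eq_columns c'_def
          by (intro mult_right_mono sum_mono2) auto
        finally show "(\<Sum>j\<in>K. norm (c' j t))\<^sup>2 \<le> (sqrt (card K) * norm (\<gamma>' t))\<^sup>2"
          by (simp add: power_mult_distrib mult.commute)
      qed simp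
      finally show ?thesis .
    qed
    have int: "(G' has_integral (G 1 - G 0)) {0..1}"
      by (intro fundamental_theorem_of_calculus dG) auto
    have "norm (integral {0..1} G') \<le> integral {0..1} (\<lambda>t. sqrt (card K) * norm (\<gamma>' t))"
    proof (rule integral_norm_bound_integral)
      show "G' integrable_on {0..1}" using int by blast
      show "(\<lambda>t. sqrt (card K) * norm (\<gamma>' t)) integrable_on {0..1}"
        by (intro integrable_continuous_interval continuous_intros cont)
    qed (use G' in simp)
    also have "\<dots> = sqrt (card K) * curve_length \<gamma>"
      using curve_length_eq[OF deriv] by simp
    also have "integral {0..1} G' = G 1 - G 0" using int by (rule integral_unique)
    also have "G 0 = card K * (z * (pi / 2))"
      using unit[of 0] arcsin_r by (simp add: G_def norm_eq_1)
    also have "G 1 = - (card K * (z * (pi / 2)))"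
    proof -
      have "c j 1 = - c j 0" if "j \<in> K" for j using K[OF that] \<gamma> by (simp add: c_def)
      then show ?thesis
        using unit[of 0] arcsin_r \<open>0 < r\<close> \<open>r < 1\<close> by (simp add: G_def norm_eq_1 arcsin_minus)
    qed
    finally have "sqrt (card K) * (z * (pi * sqrt (card K))) \<le> sqrt (card K) * curve_length \<gamma>"
      using z by (simp add: algebra_simps)
    \<comment> \<open>One factor \<open>sqrt (card K)\<close> is cancelled; for empty
      \<open>K\<close> the claim reduces to nonnegativity of the length.\<close>
    then show ?thesis
      using curve_length_nonneg[of \<gamma>] by (cases "card K = 0") (auto simp del: card_0_eq)
  qed
  then show ?thesis by (rule field_le_mult_one_interval)
qed

section \<open>The sign changes and the maximum\<close>

text \<open>The rank, that is the number of smaller indices, is strictly monotone, hence a bijection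
  onto \<open>{..<CARD('p)}\<close>. This makes \<open>h k\<close> flip exactly \<open>k\<close>
  columns.\<close>

lemma card_first_indices:
  assumes "k \<le> CARD('p::{finite,linorder})"
  shows "card {j :: 'p. card {l. l < j} < k} = k"
proof -
  let ?rank = "\<lambda>j :: 'p. card {l. l < j}"
  have mono: "?rank i < ?rank j" if "i < j" for i j
    using that by (intro psubset_card_mono) auto
  then have inj: "inj ?rank"
    by (intro linorder_injI less_imp_neq mono)
  have "?rank ` UNIV \<subseteq> {..<CARD('p)}"
    by (auto intro!: psubset_card_mono)
  then have "?rank ` UNIV = {..<CARD('p)}"
    using inj by (intro card_subset_eq) (simp_all add: card_image)
  then have "?rank ` {j. ?rank j < k} = {..<k}"
    using assms by (auto simp: set_eq_iff image_iff) (metis less_le_trans)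
  then show ?thesis
    using card_image[OF inj_on_subset[OF inj], of "{j. ?rank j < k}"] by simp
qed

lemma column_h:
  "column j (h k U) = (if card {l. l < j} < k then - column j U else column j U)"
proof -
  have "(\<Sum>l\<in>UNIV. U $ i $ l * (if l = j then s else 0)) = U $ i $ j * s" for i s
    by (simp add: if_distrib[of "\<lambda>x. _ * x"] cong: if_cong)
  moreover have "h k U $ i $ j = (\<Sum>l\<in>UNIV. U $ i $ l *
      (if l = j then if card {l. l < j} < k then - 1 else 1 else 0))" for i
    unfolding h_def matrix_matrix_mult_def sign_matrix_def by (auto intro!: sum.cong)
  ultimately have "h k U $ i $ j = U $ i $ j * (if card {l. l < j} < k then - 1 else 1)" for i
    by presburger
  then show ?thesis by (simp add: column_def vec_eq_iff)
qed

lemma h_in_stiefel: "U \<in> stiefel \<Longrightarrow> h k U \<in> stiefel"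
  by (auto simp: stiefel_iff_columns column_h)

lemma norm_h_diff:
  fixes U :: "real ^ ('p::{finite,linorder}) ^ 'n"
  assumes "U \<in> stiefel" "k \<le> CARD('p)"
  shows "norm (h k U - U) = 2 * sqrt (real k)"
proof -
  have unit: "norm (column j U) = 1" for j
    using assms(1) by (simp add: stiefel_iff_columns norm_eq_1)
  have "(norm (h k U - U))\<^sup>2 = (\<Sum>j\<in>(UNIV :: 'p set). if card {l. l < j} < k then 4 else 0)"
    unfolding norm_eq_columns column_diff column_h
  proof (rule sum.cong)
    fix j :: 'p
    have "- column j U - column j U = - 2 *\<^sub>R column j U" by (simp add: scaleR_2)
    then show "(norm ((if card {l. l < j} < k then - column j U else column j U) - column j U))\<^sup>2
        = (if card {l. l < j} < k then 4 else 0)"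
      by (simp add: unit)
  qed simp
  also have "\<dots> = (2 * sqrt (real k))\<^sup>2"
    using card_first_indices[OF assms(2)] by (simp add: sum.If_cases power_mult_distrib)
  finally show ?thesis by (rule power2_eq_imp_eq) simp_all
qed

text \<open>The maximum defining \<open>M_E\<close> has to be attained by some pair. Distinct
  coordinate vectors serve as columns.\<close>

lemma stiefel_nonempty:
  assumes "CARD('p) \<le> CARD('n)"
  shows "(stiefel :: (real ^ 'p ^ 'n) set) \<noteq> {}"
proof -
  obtain f :: "'p \<Rightarrow> 'n" where f: "inj f"
    using card_le_inj[of "UNIV :: 'p set" "UNIV :: 'n set"] assms by auto
  define U :: "real ^ 'p ^ 'n" where "U = (\<chi> i j. if i = f j then 1 else 0)"
  have "column j U = axis (f j) 1" for j
    by (simp add: U_def column_def axis_def vec_eq_iff)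
  then have "U \<in> stiefel"
    using f by (simp add: stiefel_iff_columns inner_axis_axis inj_eq)
  then show ?thesis by blast
qed

text \<open>The upper bound for arbitrary pairs and the lower bound for antipodal columns coincide
  here.\<close>

lemma d_E_h:
  fixes U :: "real ^ ('p::{finite,linorder}) ^ 'n"
  assumes "CARD('p) < CARD('n)" "U \<in> stiefel" "k \<le> CARD('p)"
  shows "d_E U (h k U) = pi * sqrt (real k)"
proof (rule antisym)
  show "d_E U (h k U) \<le> pi * sqrt (real k)"
    using d_E_le[OF assms(1,2) h_in_stiefel[OF assms(2)], of k] norm_h_diff[OF assms(2,3)] by simp
  show "pi * sqrt (real k) \<le> d_E U (h k U)"
    unfolding d_E_def
  proof (rule cInf_greatest)
    show "{curve_length \<gamma> |\<gamma>. C1_curve_in stiefel \<gamma> \<and> \<gamma> 0 = U \<and> \<gamma> 1 = h k U} \<noteq> {}"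
      using short_curve_exists[OF assms(1,2) h_in_stiefel[OF assms(2)]] by blast
    fix x assume "x \<in> {curve_length \<gamma> |\<gamma>. C1_curve_in stiefel \<gamma> \<and> \<gamma> 0 = U \<and> \<gamma> 1 = h k U}"
    then obtain \<gamma> where "x = curve_length \<gamma>" "C1_curve_in stiefel \<gamma>" "\<gamma> 0 = U" "\<gamma> 1 = h k U"
      by blast
    then show "pi * sqrt (real k) \<le> x"
      using curve_length_antipodal_columns[of \<gamma> U "h k U" "{j. card {l. l < j} < k}"]
      by (simp add: column_h card_first_indices[OF assms(3)])
  qed
qed

theorem theorem6p8:
  assumes "CARD('n::finite) \<ge> 2 * CARD('p::{finite,linorder})"
  shows "\<forall>k\<in>{1..CARD('p::{finite,linorder})}.
    (\<forall>U\<in>(stiefel :: (real ^ ('p::{finite,linorder}) ^ 'n) set).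
       d_E U (h k U) = pi / 2 * norm (h k U - U) \<and>
       pi / 2 * norm (h k U - U) = pi * sqrt (real k)) \<and>
    M_E_hat (2 * sqrt (real k)) = M_E TYPE(real ^ ('p::{finite,linorder}) ^ 'n) (2 * sqrt (real k))"
proof
  fix k assume "k \<in> {1..CARD('p)}"
  then have k: "1 \<le> k" "k \<le> CARD('p)" by auto
  have less: "CARD('p) < CARD('n)" using assms zero_less_card_finite[where 'a = 'p] by linarith
  \<comment> \<open>At \<open>k = 1\<close> the argument is exactly 2, where the
    \<open>arcsin\<close> branch gives \<open>2 * arcsin 1 = pi\<close>; for larger \<open>k\<close>
    the linear branch applies.\<close>
  have hat: "M_E_hat (2 * sqrt (real k)) = pi * sqrt (real k)"
  proof (cases "k = 1")
    case False
    with k have "1 < sqrt (real k)" by simp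
    then show ?thesis by (simp add: M_E_hat_def)
  qed (simp add: M_E_hat_def)
  have "M_E TYPE(real ^ ('p::{finite,linorder}) ^ 'n) (2 * sqrt (real k)) = pi * sqrt (real k)"
    unfolding M_E_def
  \<comment> \<open>The pair \<open>U\<close>, \<open>h k U\<close> attains the value, and
    \<open>d_E_le\<close> bounds every pair at the same Frobenius distance by it.\<close>
  proof (rule Greatest_equality)
    obtain U :: "real ^ ('p::{finite,linorder}) ^ 'n" where U: "U \<in> stiefel"
      using stiefel_nonempty less by (metis ex_in_conv less_imp_le)
    then show "pi * sqrt (real k) \<in> {d_E U V |U V :: real ^ ('p::{finite,linorder}) ^ 'n.
        U \<in> stiefel \<and> V \<in> stiefel \<and> norm (V - U) = 2 * sqrt (real k)}"
      using d_E_h[OF less U k(2)] norm_h_diff[OF U k(2)] h_in_stiefel[OF U, of k] by force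
  next
    fix d assume "d \<in> {d_E U V |U V :: real ^ ('p::{finite,linorder}) ^ 'n.
        U \<in> stiefel \<and> V \<in> stiefel \<and> norm (V - U) = 2 * sqrt (real k)}"
    then obtain U V :: "real ^ ('p::{finite,linorder}) ^ 'n" where "d = d_E U V" "U \<in> stiefel" "V \<in> stiefel"
      "norm (V - U) = 2 * sqrt (real k)" by blast
    then show "d \<le> pi * sqrt (real k)" using d_E_le[OF less, of U V] by simp
  qed
  then show "(\<forall>U\<in>(stiefel :: (real ^ ('p::{finite,linorder}) ^ 'n) set).
       d_E U (h k U) = pi / 2 * norm (h k U - U) \<and>
       pi / 2 * norm (h k U - U) = pi * sqrt (real k)) \<and>
    M_E_hat (2 * sqrt (real k)) = M_E TYPE(real ^ ('p::{finite,linorder}) ^ 'n) (2 * sqrt (real k))"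
    using hat by (simp add: d_E_h[OF less _ k(2)] norm_h_diff[OF _ k(2)])
qed

end
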